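(* Let $G$ be a finite abelian group, let $\chi_{1}$ be the trivial representation of $G$, and let $\sum_{g \in G} x_{g} g \in \mathbb{C}G$ (with $x_{g} \in \mathbb{C}$ for every $g \in G$) be such that $\Theta(G) \neq 0$, where $\Theta(G) = \det\left(x_{gh^{-1}}\right)_{g,h \in G} \in \mathbb{C}$. Then $$ \left( \sum_{g \in G} x_{g} g \right)^{-1} = \frac{1}{\Theta(G)} \prod_{\chi \in \widehat{G} \setminus \{ \chi_{1} \}} \left( \sum_{g \in G} \chi(g) x_{g} g \right) $$ in $\mathbb{C}G$.
   Context: $\mathbb{C}G$ is the group algebra of $G$ over $\mathbb{C}$. In this statement the $x_{g}$ are complex numbers (not variables), and $\Theta(G)$ is the determinant of the complex matrix $(x_{gh^{-1}})_{g,h\in G}$ with rows and columns indexed by the elements of $G$ (in the same, arbitrary, ordering). $\widehat{G}$ is the group of characters of $G$, i.e. of group homomorphisms $G \to \mathbb{C}^{\times}$; $\chi_1$ is the character with constant value $1$. *)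

theory Defs
  imports
    "HOL-Algebra.Module"
    "Jordan_Normal_Form.Determinant"
begin

(* Elements of the group algebra are the finitely supported functions on the group,
   extended by 0 outside the carrier so that equality in the algebra is equality in HOL. *)
definition group_algebra :: "('a, 'm) monoid_scheme \<Rightarrow> (complex, 'a \<Rightarrow> complex) module" where
  "group_algebra G =
    \<lparr> carrier = {a. finite {g. a g \<noteq> 0} \<and> {g. a g \<noteq> 0} \<subseteq> carrier G},
      monoid.mult = (\<lambda>a b k. \<Sum>g\<in>{g. a g \<noteq> 0}. \<Sum>h\<in>{h. b h \<noteq> 0}.
                        if g \<otimes>\<^bsub>G\<^esub> h = k then a g * b h else 0),
      monoid.one = (\<lambda>g. if g = \<one>\<^bsub>G\<^esub> then 1 else 0),
      ring.zero = (\<lambda>g. 0),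
      ring.add = (\<lambda>a b g. a g + b g),
      module.smult = (\<lambda>c a g. c * a g) \<rparr>"

definition group_elem :: "'a \<Rightarrow> 'a \<Rightarrow> complex" where
  "group_elem g = (\<lambda>h. if h = g then 1 else 0)"

definition complex_units :: "complex monoid" where
  "complex_units = \<lparr> carrier = UNIV - {0}, monoid.mult = (*), monoid.one = 1 \<rparr>"

(* Characters are required to be extensional: hom only constrains values on the carrier,
   so without this each character would have many HOL representatives. *)
definition character_group :: "('a, 'm) monoid_scheme \<Rightarrow> ('a \<Rightarrow> complex) monoid" where
  "character_group G =
    \<lparr> carrier = hom G complex_units \<inter> extensional (carrier G),
      monoid.mult = (\<lambda>\<chi> \<psi>. \<lambda>g\<in>carrier G. \<chi> g * \<psi> g),
      monoid.one = (\<lambda>g\<in>carrier G. 1) \<rparr>"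

(* Group determinant for the ordering e 0, e 1, ..., e (n - 1) of the n elements. *)
definition group_det :: "('a, 'm) monoid_scheme \<Rightarrow> (nat \<Rightarrow> 'a) \<Rightarrow> ('a \<Rightarrow> complex) \<Rightarrow> complex" where
  "group_det G e x =
    det (mat (card (carrier G)) (card (carrier G)) (\<lambda>(i, j). x (e i \<otimes>\<^bsub>G\<^esub> inv\<^bsub>G\<^esub> (e j))))"

end

theory Submission
  imports Defs "HOL-Algebra.Multiplicative_Group"
begin

text \<open>
  The algebra \<open>\<complex>G\<close> of a finite abelian group is a product of copies of \<open>\<complex>\<close>, one for each
  character: the Fourier transform \<open>a \<mapsto> (\<chi> \<mapsto> \<Sum>\<^sub>g a\<^sub>g \<chi>(g))\<close> is multiplicative (lemma
  \<open>fourier_mult\<close>) and injective (lemma \<open>fourier_eqI\<close>). An identity in \<open>\<complex>G\<close> may therefore be checked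
  one character at a time, where it is an identity between complex numbers. Even the ring axioms
  for \<open>\<complex>G\<close> are obtained in this way.

  The transform at \<open>\<psi>\<close> of the twisted element \<open>\<Sum>\<^sub>g \<chi>(g) x\<^sub>g g\<close> is the transform of \<open>x\<close> at \<open>\<psi>\<chi>\<close>. When
  \<open>\<chi>\<close> runs over all characters, so does \<open>\<psi>\<chi>\<close>; hence at every \<open>\<psi>\<close> the product of all twists,
  \<open>x\<close> itself included as the twist by the trivial character, has the value \<open>\<Prod>\<^sub>\<chi> \<Sum>\<^sub>g x\<^sub>g \<chi>(g)\<close>,
  which does not depend on \<open>\<psi>\<close> (lemma \<open>prod_fourier_twists\<close>). By Dedekind's factorization of the
  group determinant (lemma \<open>group_det_eq_prod_fourier\<close>) this value is \<open>\<Theta>(G)\<close>. So the product of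
  all twists is \<open>\<Theta>(G)\<close> times the identity of \<open>\<complex>G\<close>, and dividing by \<open>\<Theta>(G)\<close> gives the inverse.

  Injectivity of the transform and Dedekind's factorization both come from the orthogonality of
  characters. Orthogonality in turn needs that there are enough characters: every \<open>g \<noteq> \<one>\<close> is
  mapped to some value other than \<open>1\<close> (lemma \<open>character_separates\<close>). This is shown by
  extending characters from subgroups, one generator at a time.
\<close>

section \<open>Extending characters from subgroups\<close>

locale finite_comm_group = comm_group G for G :: "('a, 'm) monoid_scheme" (structure) +
  assumes finite_carrier: "finite (carrier G)"
begin

abbreviation characters :: "('a \<Rightarrow> complex) set" where
  "characters \<equiv> carrier (character_group G)"

text \<open>
  A character of a subgroup \<open>H\<close>. Values outside \<open>H\<close> are left arbitrary, so that a character of a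
  larger subgroup is an extension as soon as it agrees with \<open>\<chi>\<close> on \<open>H\<close>.
\<close>

definition partial_character :: "'a set \<Rightarrow> ('a \<Rightarrow> complex) \<Rightarrow> bool" where
  "partial_character H \<chi> \<longleftrightarrow>
     subgroup H G \<and> (\<forall>h\<in>H. \<chi> h \<noteq> 0) \<and> (\<forall>h\<in>H. \<forall>k\<in>H. \<chi> (h \<otimes> k) = \<chi> h * \<chi> k)"

lemma partial_character_one:
  assumes "partial_character H \<chi>"
  shows "\<chi> \<one> = 1"
proof -
  have "\<one> \<in> H" using assms by (simp add: partial_character_def subgroup.one_closed)
  then have "\<chi> \<one> \<noteq> 0" "\<chi> (\<one> \<otimes> \<one>) = \<chi> \<one> * \<chi> \<one>"
    using assms unfolding partial_character_def by blast+
  then show ?thesis by simp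
qed

lemma partial_character_inv:
  assumes "partial_character H \<chi>" "h \<in> H"
  shows "\<chi> (inv h) = inverse (\<chi> h)"
proof -
  have "inv h \<in> H" "h \<in> carrier G"
    using assms by (auto simp: partial_character_def subgroup.m_inv_closed dest: subgroup.mem_carrier)
  moreover have "\<chi> (h \<otimes> inv h) = \<chi> h * \<chi> (inv h)"
    using assms \<open>inv h \<in> H\<close> by (simp add: partial_character_def)
  ultimately show ?thesis
    using partial_character_one[OF assms(1)] by (simp add: inverse_unique)
qed

lemma partial_character_nat_pow:
  fixes n :: nat
  assumes "partial_character H \<chi>" "h \<in> H"
  shows "h [^] n \<in> H \<and> \<chi> (h [^] n) = \<chi> h ^ n"
proof (induction n)
  case 0
  show ?case using assms partial_character_one[OF assms(1)]
    by (simp add: partial_character_def subgroup.one_closed)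
next
  case (Suc n)
  then show ?case using assms by (simp add: partial_character_def subgroup.m_closed)
qed

lemma partial_character_int_pow:
  fixes n :: int
  assumes "partial_character H \<chi>" "h \<in> H"
  shows "h [^] n \<in> H \<and> \<chi> (h [^] n) = \<chi> h powi n"
proof (cases "n \<ge> 0")
  case True
  then obtain m where "n = int m" using zero_le_imp_eq_int by blast
  then show ?thesis using partial_character_nat_pow[OF assms, of m] by (simp add: int_pow_int)
next
  case False
  then obtain m where m: "n = - int m" by (metis le_minus_iff neg_0_le_iff_le nle_le zero_le_imp_eq_int minus_minus)
  have "h \<in> carrier G" using assms by (auto simp: partial_character_def dest: subgroup.mem_carrier)
  then have "h [^] n = inv (h [^] m)" by (simp add: m int_pow_neg int_pow_int)
  moreover have "h [^] m \<in> H" and "\<chi> (h [^] m) = \<chi> h ^ m"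
    using partial_character_nat_pow[OF assms] by blast+
  ultimately show ?thesis
    using assms partial_character_inv[OF assms(1), of "h [^] m"]
    by (simp add: m partial_character_def subgroup.m_inv_closed power_int_minus)
qed

text \<open>
  The only relations between \<open>a\<close> and \<open>H\<close> are consequences of \<open>a [^] d \<in> H\<close>, where \<open>d\<close> is the order
  of \<open>a\<close> modulo \<open>H\<close>. So the value at \<open>a\<close> may be any \<open>d\<close>-th root of \<open>\<chi> (a [^] d)\<close>: then
  \<open>h \<otimes> a [^] k \<mapsto> \<chi> h * w\<^sup>k\<close> is well defined on the subgroup generated by \<open>H\<close> and \<open>a\<close>.
\<close>

lemma extend_partial_character:
  assumes \<chi>: "partial_character H \<chi>" and a: "a \<in> carrier G"
    and d: "d > 0" "a [^] d \<in> H" and least: "\<And>m::nat. 0 < m \<Longrightarrow> a [^] m \<in> H \<Longrightarrow> d \<le> m"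
    and w: "w ^ d = \<chi> (a [^] d)"
  shows "\<exists>K \<psi>. partial_character K \<psi> \<and> insert a H \<subseteq> K \<and> (\<forall>h\<in>H. \<psi> h = \<chi> h) \<and> \<psi> a = w"
proof -
  have H: "subgroup H G" and nz: "\<And>h. h \<in> H \<Longrightarrow> \<chi> h \<noteq> 0"
    and mult: "\<And>h k. h \<in> H \<Longrightarrow> k \<in> H \<Longrightarrow> \<chi> (h \<otimes> k) = \<chi> h * \<chi> k"
    using \<chi> by (auto simp: partial_character_def)
  have HG: "\<And>h. h \<in> H \<Longrightarrow> h \<in> carrier G" using H by (rule subgroup.mem_carrier)
  have w0: "w \<noteq> 0" using nz[OF d(2)] w d(1) by (metis power_0_left neq0_conv)
  \<comment> \<open>The exponents \<open>m\<close> with \<open>a [^] m \<in> H\<close> are multiples of \<open>d\<close>, because the remainder modulo \<open>d\<close>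
    is again such an exponent and \<open>d\<close> is least.\<close>
  have pow: "\<chi> (a [^] m) = w powi m" if "a [^] m \<in> H" for m :: int
  proof -
    have ad: "(a [^] d) [^] (m div int d) = a [^] (int d * (m div int d))"
      using a by (simp add: int_pow_pow flip: int_pow_int)
    have adH: "(a [^] d) [^] (m div int d) \<in> H"
      and ad\<chi>: "\<chi> ((a [^] d) [^] (m div int d)) = \<chi> (a [^] d) powi (m div int d)"
      using partial_character_int_pow[OF \<chi> d(2)] by blast+
    have "a [^] (m mod int d) = a [^] m \<otimes> inv (a [^] (int d * (m div int d)))"
      using int_pow_diff[OF a, of m "int d * (m div int d)"]
      by (simp add: minus_mult_div_eq_mod)
    also have "\<dots> \<in> H"
      using that adH H by (simp add: ad subgroup.m_closed subgroup.m_inv_closed)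
    finally have "a [^] nat (m mod int d) \<in> H" using d(1) by (simp flip: int_pow_int)
    then have "m mod int d = 0"
      using least[of "nat (m mod int d)"] d(1) pos_mod_bound[of "int d" m] pos_mod_sign[of "int d" m]
      by linarith
    then have m: "int d * (m div int d) = m" by auto
    have "\<chi> (a [^] m) = (w ^ d) powi (m div int d)"
      using ad\<chi> by (simp only: ad m w)
    also have "\<dots> = w powi m"
      using power_int_mult[of w "int d" "m div int d"] m by simp
    finally show ?thesis .
  qed
  define K where "K = {h \<otimes> a [^] (k::int) |h k. h \<in> H}"
  define \<psi> where "\<psi> z = (SOME c. \<exists>h\<in>H. \<exists>k::int. z = h \<otimes> a [^] k \<and> c = \<chi> h * w powi k)" for z
  have \<psi>: "\<psi> (h \<otimes> a [^] k) = \<chi> h * w powi k" if h: "h \<in> H" for h and k :: int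
  proof -
    have "\<exists>h'\<in>H. \<exists>k'::int. h \<otimes> a [^] k = h' \<otimes> a [^] k' \<and> \<psi> (h \<otimes> a [^] k) = \<chi> h' * w powi k'"
      unfolding \<psi>_def by (rule someI[where x = "\<chi> h * w powi k"]) (use h in blast)
    then obtain h' and k' :: int where h': "h' \<in> H" and eq: "h \<otimes> a [^] k = h' \<otimes> a [^] k'"
      and val: "\<psi> (h \<otimes> a [^] k) = \<chi> h' * w powi k'"
      by blast
    \<comment> \<open>Two representations of one element differ by a power of \<open>a\<close> that lies in \<open>H\<close>.\<close>
    have *: "h = h' \<otimes> a [^] (k' - k)"
    proof -
      have "h = (h \<otimes> a [^] k) \<otimes> inv (a [^] k)" using h a HG by (simp add: m_assoc)
      also have "\<dots> = h' \<otimes> a [^] (k' - k)" using eq h' a HG by (simp add: m_assoc int_pow_diff)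
      finally show ?thesis .
    qed
    then have "a [^] (k' - k) = inv h' \<otimes> h" using h h' a HG by (simp add: inv_solve_left)
    then have mem: "a [^] (k' - k) \<in> H" using h h' H by (simp add: subgroup.m_closed subgroup.m_inv_closed)
    have "\<chi> h = \<chi> h' * w powi (k' - k)" using * mult[OF h' mem] pow[OF mem] by simp
    then show ?thesis using val w0 by (simp add: power_int_diff)
  qed
  have K_mem: "h \<otimes> a [^] k \<in> K" if "h \<in> H" for h and k :: int
    using that by (auto simp: K_def)
  have prod: "(h \<otimes> a [^] k) \<otimes> (h' \<otimes> a [^] k') = (h \<otimes> h') \<otimes> a [^] (k + k')"
    if "h \<in> H" "h' \<in> H" for h h' and k k' :: int
    using that a HG by (simp add: int_pow_mult m_ac)
  have sub: "subgroup K G"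
  proof (rule subgroupI)
    show "K \<subseteq> carrier G" using a HG by (auto simp: K_def)
    show "K \<noteq> {}" using H subgroup.one_closed by (fastforce simp: K_def)
  next
    fix z assume "z \<in> K"
    then obtain h and k :: int where z: "z = h \<otimes> a [^] k" "h \<in> H" by (auto simp: K_def)
    then have "inv z = inv h \<otimes> a [^] (- k)"
      using a HG by (simp add: inv_mult int_pow_neg)
    then show "inv z \<in> K" using z H by (auto simp: K_def intro: subgroup.m_inv_closed)
  next
    fix y z assume "y \<in> K" "z \<in> K"
    then show "y \<otimes> z \<in> K"
      using prod H by (fastforce simp: K_def intro: subgroup.m_closed)
  qed
  have "partial_character K \<psi>"
    unfolding partial_character_def
  proof (intro conjI ballI)
    fix y assume "y \<in> K"
    then show "\<psi> y \<noteq> 0" using \<psi> nz w0 by (auto simp: K_def)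
  next
    fix y z assume "y \<in> K" "z \<in> K"
    then obtain h h' and k k' :: int where "y = h \<otimes> a [^] k" "h \<in> H" "z = h' \<otimes> a [^] k'" "h' \<in> H"
      by (auto simp: K_def)
    then show "\<psi> (y \<otimes> z) = \<psi> y * \<psi> z"
      using H w0 by (simp add: prod \<psi> mult subgroup.m_closed power_int_add)
  qed (rule sub)
  moreover have "\<psi> h = \<chi> h \<and> h \<in> K" if "h \<in> H" for h
    using \<psi>[OF that, of 0] K_mem[OF that, of 0] HG[OF that] by simp
  moreover have "\<psi> a = w \<and> a \<in> K"
    using \<psi>[of \<one> 1] K_mem[of \<one> 1] subgroup.one_closed[OF H] a partial_character_one[OF \<chi>]
    by simp
  ultimately show ?thesis by blast
qed

lemma mem_characters_iff:
  "\<chi> \<in> characters \<longleftrightarrow> partial_character (carrier G) \<chi> \<and> \<chi> \<in> extensional (carrier G)"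
  by (auto simp: character_group_def hom_def complex_units_def partial_character_def subgroup_self)

lemma least_pow_in_subgroup:
  assumes "subgroup H G" "a \<in> carrier G"
  obtains d :: nat where "d > 0" "a [^] d \<in> H" "\<And>m. 0 < m \<Longrightarrow> a [^] m \<in> H \<Longrightarrow> d \<le> m"
proof -
  have "0 < Coset.order G \<and> a [^] Coset.order G \<in> H"
    using assms finite_carrier by (simp add: order_gt_0_iff_finite pow_order_eq_1 subgroup.one_closed)
  then show ?thesis
    using LeastI[of "\<lambda>m. 0 < m \<and> a [^] m \<in> H"] Least_le[of "\<lambda>m. 0 < m \<and> a [^] m \<in> H"]
    by (intro that[of "LEAST m. 0 < m \<and> a [^] m \<in> H"]) blast+
qed

text \<open>
  Take a character of a subgroup that contains \<open>g\<close> and is nontrivial at \<open>g\<close>, with the subgroup as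
  large as possible. The subgroup must be all of \<open>G\<close>, since otherwise the character would extend
  to one more element. Extension also provides the starting point: the trivial character of
  \<open>{\<one>}\<close> extends to the powers of \<open>g\<close> with a root of unity other than \<open>1\<close> as its value at \<open>g\<close>.
\<close>

lemma character_separates:
  assumes g: "g \<in> carrier G" "g \<noteq> \<one>"
  obtains \<chi> where "\<chi> \<in> characters" "\<chi> g \<noteq> 1"
proof -
  define P where "P H \<longleftrightarrow> (\<exists>\<chi>. partial_character H \<chi> \<and> g \<in> H \<and> \<chi> g \<noteq> 1)" for H
  have "\<exists>H. P H"
  proof -
    have triv: "partial_character {\<one>} (\<lambda>_. 1)"
      by (simp add: partial_character_def triv_subgroup)
    obtain d :: nat where d: "d > 0" "g [^] d \<in> {\<one>}" "\<And>m. 0 < m \<Longrightarrow> g [^] m \<in> {\<one>} \<Longrightarrow> d \<le> m"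
      using least_pow_in_subgroup[OF triv_subgroup g(1)] by blast
    have "d \<noteq> 1" using d(2) g by auto
    then have "card {z::complex. z ^ d = 1} \<noteq> card {1::complex}"
      using card_roots_unity_eq[OF d(1)] by simp
    then have "{z::complex. z ^ d = 1} \<noteq> {1}" by metis
    then obtain w :: complex where "w ^ d = 1" "w \<noteq> 1" by auto
    then show ?thesis
      using extend_partial_character[OF triv g(1) d(1,2) d(3), of w] unfolding P_def by blast
  qed
  moreover have "\<forall>H. P H \<longrightarrow> card H < Suc (Coset.order G)"
    using finite_carrier
    by (auto simp: P_def partial_character_def Coset.order_def less_Suc_eq_le
          intro!: card_mono dest: subgroup.subset)
  ultimately obtain H where H: "P H" and max: "\<And>K. P K \<Longrightarrow> card K \<le> card H"
    using ex_has_greatest_nat[of P _ card] by blast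
  from H obtain \<chi> where \<chi>: "partial_character H \<chi>" "g \<in> H" "\<chi> g \<noteq> 1" unfolding P_def by blast
  then have sub: "subgroup H G" by (simp add: partial_character_def)
  have "H = carrier G"
  proof (rule ccontr)
    assume "H \<noteq> carrier G"
    then obtain a where a: "a \<in> carrier G" "a \<notin> H" using subgroup.subset[OF sub] by blast
    obtain d :: nat where d: "d > 0" "a [^] d \<in> H" "\<And>m. 0 < m \<Longrightarrow> a [^] m \<in> H \<Longrightarrow> d \<le> m"
      using least_pow_in_subgroup[OF sub a(1)] by blast
    have "\<chi> (a [^] d) \<noteq> 0" using \<chi>(1) d(2) by (simp add: partial_character_def)
    then have "card {z. z ^ d = \<chi> (a [^] d)} = d" using d(1) by (rule card_nth_roots)
    then have "{z. z ^ d = \<chi> (a [^] d)} \<noteq> {}" using d(1) by (metis card.empty less_irrefl)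
    then obtain w where "w ^ d = \<chi> (a [^] d)" by blast
    then obtain K \<psi> where K: "partial_character K \<psi>" "insert a H \<subseteq> K" "\<forall>h\<in>H. \<psi> h = \<chi> h"
      using extend_partial_character[OF \<chi>(1) a(1) d(1,2) d(3)] by blast
    then have "P K" using \<chi>(2,3) unfolding P_def by auto
    moreover have "finite K" using K(1) finite_carrier finite_subset subgroup.subset
      unfolding partial_character_def by blast
    then have "card H < card K" using K(2) a(2) by (intro psubset_card_mono) auto
    ultimately show False using max by fastforce
  qed
  moreover have "\<And>h. h \<in> carrier G \<Longrightarrow> restrict \<chi> (carrier G) h = \<chi> h" by simp
  ultimately have "restrict \<chi> (carrier G) \<in> characters"
    using \<chi>(1) by (auto simp: mem_characters_iff partial_character_def)
  then show ?thesis using \<chi>(3) g(1) by (intro that[of "restrict \<chi> (carrier G)"]) auto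
qed

section \<open>Orthogonality of characters\<close>

lemma character_nonzero: "\<chi> \<in> characters \<Longrightarrow> g \<in> carrier G \<Longrightarrow> \<chi> g \<noteq> 0"
  by (auto simp: mem_characters_iff partial_character_def)

lemma character_mult:
  "\<chi> \<in> characters \<Longrightarrow> g \<in> carrier G \<Longrightarrow> h \<in> carrier G \<Longrightarrow> \<chi> (g \<otimes> h) = \<chi> g * \<chi> h"
  by (auto simp: mem_characters_iff partial_character_def)

lemma character_one: "\<chi> \<in> characters \<Longrightarrow> \<chi> \<one> = 1"
  by (auto simp: mem_characters_iff dest: partial_character_one)

lemma character_eqI:
  assumes "\<chi> \<in> characters" "\<psi> \<in> characters" "\<And>g. g \<in> carrier G \<Longrightarrow> \<chi> g = \<psi> g"
  shows "\<chi> = \<psi>"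
  using assms by (auto simp: mem_characters_iff intro: extensionalityI)

text \<open>
  The values of a character are roots of unity of a fixed order, so there are only finitely many
  choices for them.
\<close>

lemma finite_characters: "finite characters"
proof (rule finite_subset)
  show "characters \<subseteq> carrier G \<rightarrow>\<^sub>E {z. z ^ Coset.order G = 1}"
  proof
    fix \<chi> assume "\<chi> \<in> characters"
    then have pc: "partial_character (carrier G) \<chi>" and ext: "\<chi> \<in> extensional (carrier G)"
      by (auto simp: mem_characters_iff)
    have "\<chi> g ^ Coset.order G = 1" if "g \<in> carrier G" for g
      using partial_character_nat_pow[OF pc that, of "Coset.order G"] pow_order_eq_1[OF that]
        partial_character_one[OF pc] by simp
    then show "\<chi> \<in> carrier G \<rightarrow>\<^sub>E {z. z ^ Coset.order G = 1}"
      using ext by (auto simp: PiE_def)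
  qed
  have "Coset.order G \<ge> 1"
    using finite_carrier by (simp add: order_gt_0_iff_finite Suc_leI)
  then show "finite (carrier G \<rightarrow>\<^sub>E {z::complex. z ^ Coset.order G = 1})"
    by (intro finite_PiE finite_carrier finite_roots_unity)
qed

lemma trivial_character: "\<one>\<^bsub>character_group G\<^esub> \<in> characters"
  by (auto simp: mem_characters_iff partial_character_def subgroup_self)
    (auto simp: character_group_def)

lemma character_mult_closed:
  "\<psi> \<in> characters \<Longrightarrow> \<chi> \<in> characters \<Longrightarrow> \<psi> \<otimes>\<^bsub>character_group G\<^esub> \<chi> \<in> characters"
  by (auto simp: mem_characters_iff partial_character_def)
    (auto simp: character_group_def)

lemma character_mult_apply:
  "g \<in> carrier G \<Longrightarrow> (\<psi> \<otimes>\<^bsub>character_group G\<^esub> \<chi>) g = \<psi> g * \<chi> g"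
  by (simp add: character_group_def)

lemma bij_character_mult:
  assumes "\<psi> \<in> characters"
  shows "bij_betw (\<lambda>\<chi>. \<psi> \<otimes>\<^bsub>character_group G\<^esub> \<chi>) characters characters"
proof -
  have inj: "inj_on (\<lambda>\<chi>. \<psi> \<otimes>\<^bsub>character_group G\<^esub> \<chi>) characters"
  proof (rule inj_onI)
    fix \<chi> \<chi>' assume *: "\<chi> \<in> characters" "\<chi>' \<in> characters"
      "\<psi> \<otimes>\<^bsub>character_group G\<^esub> \<chi> = \<psi> \<otimes>\<^bsub>character_group G\<^esub> \<chi>'"
    show "\<chi> = \<chi>'"
    proof (rule character_eqI[OF *(1,2)])
      fix g assume g: "g \<in> carrier G"
      then have "\<psi> g * \<chi> g = \<psi> g * \<chi>' g"
        using *(3) character_mult_apply by metis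
      then show "\<chi> g = \<chi>' g" using character_nonzero[OF assms g] by simp
    qed
  qed
  moreover have "(\<lambda>\<chi>. \<psi> \<otimes>\<^bsub>character_group G\<^esub> \<chi>) ` characters \<subseteq> characters"
    using character_mult_closed[OF assms] by blast
  ultimately show ?thesis
    using endo_inj_surj[OF finite_characters] by (simp add: bij_betw_def)
qed

lemma bij_mult_left: "a \<in> carrier G \<Longrightarrow> bij_betw (\<lambda>g. a \<otimes> g) (carrier G) (carrier G)"
  by (simp add: bij_betw_def inj_on_cmult surj_const_mult)

text \<open>
  Translating the summation variable by \<open>a\<close> multiplies the sum by \<open>\<chi> a\<close>; if \<open>\<chi> a \<noteq> 1\<close>, the sum must
  vanish. The dual relation below follows in the same way by multiplying all characters by a
  character that is nontrivial at \<open>g\<close>.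
\<close>

lemma sum_character_group:
  assumes "\<chi> \<in> characters"
  shows "(\<Sum>g\<in>carrier G. \<chi> g) = (if \<chi> = \<one>\<^bsub>character_group G\<^esub> then of_nat (card (carrier G)) else 0)"
proof (cases "\<chi> = \<one>\<^bsub>character_group G\<^esub>")
  case True
  have "(\<Sum>g\<in>carrier G. \<chi> g) = (\<Sum>g\<in>carrier G. 1)"
    by (rule sum.cong) (auto simp: True character_group_def)
  then show ?thesis using True by simp
next
  case False
  then obtain a where a: "a \<in> carrier G" "\<chi> a \<noteq> \<one>\<^bsub>character_group G\<^esub> a"
    using character_eqI[OF assms trivial_character] by blast
  then have ne: "\<chi> a \<noteq> 1" by (simp add: character_group_def)
  have "(\<Sum>g\<in>carrier G. \<chi> g) = (\<Sum>g\<in>carrier G. \<chi> (a \<otimes> g))"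
    by (rule sum.reindex_bij_betw[OF bij_mult_left[OF a(1)], symmetric])
  also have "\<dots> = \<chi> a * (\<Sum>g\<in>carrier G. \<chi> g)"
    unfolding sum_distrib_left by (rule sum.cong) (use a assms in \<open>auto simp: character_mult\<close>)
  finally show ?thesis using ne False by simp
qed

lemma sum_characters_at_nontrivial:
  assumes g: "g \<in> carrier G" "g \<noteq> \<one>"
  shows "(\<Sum>\<chi>\<in>characters. \<chi> g) = 0"
proof -
  obtain \<psi> where \<psi>: "\<psi> \<in> characters" "\<psi> g \<noteq> 1" using character_separates[OF g] by blast
  have "(\<Sum>\<chi>\<in>characters. \<chi> g) = (\<Sum>\<chi>\<in>characters. (\<psi> \<otimes>\<^bsub>character_group G\<^esub> \<chi>) g)"
    by (rule sum.reindex_bij_betw[OF bij_character_mult[OF \<psi>(1)], symmetric])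
  also have "\<dots> = \<psi> g * (\<Sum>\<chi>\<in>characters. \<chi> g)"
    by (simp add: character_mult_apply g sum_distrib_left)
  finally show ?thesis using \<psi>(2) by simp
qed

text \<open>
  Both sides are values of \<open>\<Sum>\<^sub>\<chi> \<Sum>\<^sub>g \<chi>(g)\<close>: only the trivial character contributes to the sum over
  \<open>\<chi>\<close>, and only the identity contributes to the sum over \<open>g\<close>.
\<close>

lemma card_characters: "card characters = card (carrier G)"
proof -
  have "of_nat (card (carrier G)) = (\<Sum>\<chi>\<in>characters. \<Sum>g\<in>carrier G. \<chi> g)"
    using finite_characters trivial_character by (simp add: sum_character_group sum.delta)
  also have "\<dots> = (\<Sum>g\<in>carrier G. \<Sum>\<chi>\<in>characters. \<chi> g)" by (rule sum.swap)
  also have "\<dots> = (\<Sum>g\<in>carrier G. if g = \<one> then of_nat (card characters) else 0)"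
    by (rule sum.cong) (auto simp: sum_characters_at_nontrivial character_one)
  also have "\<dots> = of_nat (card characters)" using finite_carrier by (simp add: sum.delta)
  finally show ?thesis by (metis of_nat_eq_iff)
qed

lemma sum_characters_at:
  assumes "g \<in> carrier G"
  shows "(\<Sum>\<chi>\<in>characters. \<chi> g) = (if g = \<one> then of_nat (card (carrier G)) else 0)"
  using assms by (auto simp: sum_characters_at_nontrivial character_one card_characters)

lemma character_inv_mult:
  assumes "\<chi> \<in> characters" "g \<in> carrier G"
  shows "\<chi> (inv g) * \<chi> g = 1"
  using assms character_mult[of \<chi> "inv g" g] by (simp add: character_one)

section \<open>The Fourier transform on the group algebra\<close>

text \<open>
  Only values on the carrier enter, so the transform applies to an arbitrary coefficient function
  and not just to elements of the group algebra.
\<close>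

definition fourier :: "('a \<Rightarrow> complex) \<Rightarrow> ('a \<Rightarrow> complex) \<Rightarrow> complex" where
  "fourier a \<chi> = (\<Sum>g\<in>carrier G. a g * \<chi> g)"

lemma fourier_inversion:
  assumes "g \<in> carrier G"
  shows "(\<Sum>\<chi>\<in>characters. \<chi> (inv g) * fourier a \<chi>) = of_nat (card (carrier G)) * a g"
proof -
  have "(\<Sum>\<chi>\<in>characters. \<chi> (inv g) * fourier a \<chi>) =
      (\<Sum>h\<in>carrier G. \<Sum>\<chi>\<in>characters. \<chi> (inv g) * (a h * \<chi> h))"
    unfolding fourier_def sum_distrib_left by (rule sum.swap)
  also have "\<dots> = (\<Sum>h\<in>carrier G. a h * (\<Sum>\<chi>\<in>characters. \<chi> (inv g \<otimes> h)))"
    unfolding sum_distrib_left by (intro sum.cong refl) (simp add: character_mult assms)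
  also have "\<dots> = (\<Sum>h\<in>carrier G. if h = g then of_nat (card (carrier G)) * a h else 0)"
  proof (intro sum.cong refl)
    fix h assume h: "h \<in> carrier G"
    have "inv g \<otimes> h = \<one> \<longleftrightarrow> h = g"
      using assms h by (metis inv_closed inv_equality l_inv inv_inv)
    then show "a h * (\<Sum>\<chi>\<in>characters. \<chi> (inv g \<otimes> h)) = (if h = g then of_nat (card (carrier G)) * a h else 0)"
      using assms h by (simp add: sum_characters_at)
  qed
  also have "\<dots> = of_nat (card (carrier G)) * a g"
    using assms finite_carrier by (simp add: sum.delta)
  finally show ?thesis .
qed

lemma mem_group_algebra_iff: "a \<in> carrier (group_algebra G) \<longleftrightarrow> (\<forall>g. g \<notin> carrier G \<longrightarrow> a g = 0)"
  using finite_carrier by (auto simp: group_algebra_def intro: finite_subset)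

lemma fourier_eqI:
  assumes "a \<in> carrier (group_algebra G)" "b \<in> carrier (group_algebra G)"
    and "\<And>\<chi>. \<chi> \<in> characters \<Longrightarrow> fourier a \<chi> = fourier b \<chi>"
  shows "a = b"
proof
  fix g
  show "a g = b g"
  proof (cases "g \<in> carrier G")
    case True
    have "(\<Sum>\<chi>\<in>characters. \<chi> (inv g) * fourier a \<chi>) = (\<Sum>\<chi>\<in>characters. \<chi> (inv g) * fourier b \<chi>)"
      using assms(3) by (intro sum.cong) auto
    moreover have "card (carrier G) \<noteq> 0" using True finite_carrier by auto
    ultimately show ?thesis by (simp add: fourier_inversion[OF True])
  qed (use assms in \<open>simp add: mem_group_algebra_iff\<close>)
qed

lemma group_algebra_add_closed:
  "a \<in> carrier (group_algebra G) \<Longrightarrow> b \<in> carrier (group_algebra G) \<Longrightarrow>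
    a \<oplus>\<^bsub>group_algebra G\<^esub> b \<in> carrier (group_algebra G)"
  unfolding mem_group_algebra_iff by (simp add: group_algebra_def)

lemma group_algebra_mult_closed:
  assumes "a \<in> carrier (group_algebra G)" "b \<in> carrier (group_algebra G)"
  shows "a \<otimes>\<^bsub>group_algebra G\<^esub> b \<in> carrier (group_algebra G)"
  unfolding mem_group_algebra_iff
proof (intro allI impI)
  fix k assume "k \<notin> carrier G"
  then have "g \<otimes> h \<noteq> k" if "a g \<noteq> 0" "b h \<noteq> 0" for g h
    using assms that unfolding mem_group_algebra_iff by blast
  then show "(a \<otimes>\<^bsub>group_algebra G\<^esub> b) k = 0"
    by (auto simp: group_algebra_def intro!: sum.neutral)
qed

lemma group_algebra_smult_closed:
  "a \<in> carrier (group_algebra G) \<Longrightarrow> c \<odot>\<^bsub>group_algebra G\<^esub> a \<in> carrier (group_algebra G)"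
  unfolding mem_group_algebra_iff by (simp add: group_algebra_def)

lemma group_algebra_one_closed: "\<one>\<^bsub>group_algebra G\<^esub> \<in> carrier (group_algebra G)"
  unfolding mem_group_algebra_iff by (auto simp: group_algebra_def)

lemma group_algebra_zero_closed: "\<zero>\<^bsub>group_algebra G\<^esub> \<in> carrier (group_algebra G)"
  unfolding mem_group_algebra_iff by (auto simp: group_algebra_def)

lemma group_elem_closed: "g \<in> carrier G \<Longrightarrow> group_elem g \<in> carrier (group_algebra G)"
  unfolding mem_group_algebra_iff by (auto simp: group_elem_def)

lemma fourier_add: "fourier (a \<oplus>\<^bsub>group_algebra G\<^esub> b) \<chi> = fourier a \<chi> + fourier b \<chi>"
  by (simp add: group_algebra_def fourier_def sum.distrib distrib_right)

lemma fourier_smult: "fourier (c \<odot>\<^bsub>group_algebra G\<^esub> a) \<chi> = c * fourier a \<chi>"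
  by (simp add: group_algebra_def fourier_def sum_distrib_left mult.assoc)

lemma fourier_zero: "fourier \<zero>\<^bsub>group_algebra G\<^esub> \<chi> = 0"
  by (simp add: group_algebra_def fourier_def)

lemma fourier_group_elem: "g \<in> carrier G \<Longrightarrow> fourier (group_elem g) \<chi> = \<chi> g"
  using finite_carrier by (simp add: group_elem_def fourier_def if_distrib[of "\<lambda>c. c * _"] sum.delta cong: if_cong)

lemma fourier_one:
  assumes "\<chi> \<in> characters"
  shows "fourier \<one>\<^bsub>group_algebra G\<^esub> \<chi> = 1"
proof -
  have "\<one>\<^bsub>group_algebra G\<^esub> = group_elem \<one>" by (simp add: group_algebra_def group_elem_def)
  then show ?thesis using assms by (simp add: fourier_group_elem character_one)
qed

lemma fourier_mult:
  assumes a: "a \<in> carrier (group_algebra G)" and b: "b \<in> carrier (group_algebra G)"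
    and \<chi>: "\<chi> \<in> characters"
  shows "fourier (a \<otimes>\<^bsub>group_algebra G\<^esub> b) \<chi> = fourier a \<chi> * fourier b \<chi>"
proof -
  define S where "S c = {g. c g \<noteq> (0::complex)}" for c :: "'a \<Rightarrow> complex"
  have S: "S c \<subseteq> carrier G" if "c \<in> carrier (group_algebra G)" for c
    using that unfolding S_def mem_group_algebra_iff by blast
  have supp: "fourier c \<chi> = (\<Sum>g\<in>S c. c g * \<chi> g)" if "c \<in> carrier (group_algebra G)" for c
    unfolding fourier_def using S[OF that] finite_carrier
    by (intro sum.mono_neutral_right) (auto simp: S_def)
  have "fourier (a \<otimes>\<^bsub>group_algebra G\<^esub> b) \<chi> =
      (\<Sum>k\<in>carrier G. \<Sum>g\<in>S a. \<Sum>h\<in>S b. (if g \<otimes> h = k then a g * b h else 0) * \<chi> k)"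
    by (simp add: fourier_def group_algebra_def S_def sum_distrib_right)
  also have "\<dots> = (\<Sum>g\<in>S a. \<Sum>k\<in>carrier G. \<Sum>h\<in>S b. (if g \<otimes> h = k then a g * b h else 0) * \<chi> k)"
    by (rule sum.swap)
  also have "\<dots> = (\<Sum>g\<in>S a. \<Sum>h\<in>S b. \<Sum>k\<in>carrier G. (if g \<otimes> h = k then a g * b h else 0) * \<chi> k)"
    by (intro sum.cong refl sum.swap)
  also have "\<dots> = (\<Sum>g\<in>S a. \<Sum>h\<in>S b. (a g * \<chi> g) * (b h * \<chi> h))"
  proof (intro sum.cong refl)
    fix g h assume "g \<in> S a" "h \<in> S b"
    then have gh: "g \<in> carrier G" "h \<in> carrier G" using S a b by blast+
    then have "(\<Sum>k\<in>carrier G. (if g \<otimes> h = k then a g * b h else 0) * \<chi> k) = a g * b h * \<chi> (g \<otimes> h)"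
      using finite_carrier by (simp add: if_distrib[of "\<lambda>c. c * _"] sum.delta' cong: if_cong)
    then show "(\<Sum>k\<in>carrier G. (if g \<otimes> h = k then a g * b h else 0) * \<chi> k) = (a g * \<chi> g) * (b h * \<chi> h)"
      using gh \<chi> by (simp add: character_mult)
  qed
  also have "\<dots> = fourier a \<chi> * fourier b \<chi>"
    using a b by (simp add: supp sum_product)
  finally show ?thesis .
qed

text \<open>
  Every axiom is an identity, and by injectivity of the transform it suffices to verify it for the
  values at each character, which are complex numbers.
\<close>

lemma group_algebra_cring: "cring (group_algebra G)"
proof (rule cringI)
  note closed = group_algebra_add_closed group_algebra_mult_closed group_algebra_smult_closed
    group_algebra_one_closed group_algebra_zero_closed
  show "abelian_group (group_algebra G)"
  proof (rule abelian_groupI)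
    fix a assume a: "a \<in> carrier (group_algebra G)"
    show "\<exists>b\<in>carrier (group_algebra G). b \<oplus>\<^bsub>group_algebra G\<^esub> a = \<zero>\<^bsub>group_algebra G\<^esub>"
      using a by (intro bexI[of _ "(-1) \<odot>\<^bsub>group_algebra G\<^esub> a"] fourier_eqI)
        (simp_all add: closed fourier_add fourier_smult fourier_zero)
  qed (auto intro!: fourier_eqI simp: closed fourier_add fourier_zero)
  show "Group.comm_monoid (group_algebra G)"
    by (rule comm_monoidI) (auto intro!: fourier_eqI simp: closed fourier_mult fourier_one)
qed (auto intro!: fourier_eqI
      simp: group_algebra_add_closed group_algebra_mult_closed fourier_mult fourier_add distrib_right)

lemma fourier_finsum:
  assumes "finite S" "F \<in> S \<rightarrow> carrier (group_algebra G)"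
  shows "fourier (\<Oplus>\<^bsub>group_algebra G\<^esub>s\<in>S. F s) \<chi> = (\<Sum>s\<in>S. fourier (F s) \<chi>)"
proof -
  interpret A: cring "group_algebra G" by (rule group_algebra_cring)
  show ?thesis using assms
    by (induction S rule: finite_induct) (auto simp: fourier_zero fourier_add Pi_def)
qed

lemma fourier_finprod:
  assumes "finite S" "F \<in> S \<rightarrow> carrier (group_algebra G)" "\<chi> \<in> characters"
  shows "fourier (\<Otimes>\<^bsub>group_algebra G\<^esub>s\<in>S. F s) \<chi> = (\<Prod>s\<in>S. fourier (F s) \<chi>)"
proof -
  interpret A: cring "group_algebra G" by (rule group_algebra_cring)
  show ?thesis using assms
    by (induction S rule: finite_induct)
      (auto simp: fourier_one fourier_mult Pi_def A.finprod_closed)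
qed

lemma group_algebra_combination_closed:
  "(\<Oplus>\<^bsub>group_algebra G\<^esub>g\<in>carrier G. x g \<odot>\<^bsub>group_algebra G\<^esub> group_elem g) \<in> carrier (group_algebra G)"
proof -
  interpret A: cring "group_algebra G" by (rule group_algebra_cring)
  show ?thesis by (intro A.finsum_closed) (simp add: group_algebra_smult_closed group_elem_closed)
qed

lemma fourier_combination:
  "fourier (\<Oplus>\<^bsub>group_algebra G\<^esub>g\<in>carrier G. x g \<odot>\<^bsub>group_algebra G\<^esub> group_elem g) \<chi> = fourier x \<chi>"
proof -
  have "fourier (\<Oplus>\<^bsub>group_algebra G\<^esub>g\<in>carrier G. x g \<odot>\<^bsub>group_algebra G\<^esub> group_elem g) \<chi> =
      (\<Sum>g\<in>carrier G. fourier (x g \<odot>\<^bsub>group_algebra G\<^esub> group_elem g) \<chi>)"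
    by (rule fourier_finsum) (simp_all add: finite_carrier group_algebra_smult_closed group_elem_closed)
  also have "\<dots> = fourier x \<chi>"
    by (simp add: fourier_smult fourier_group_elem fourier_def[of x])
  finally show ?thesis .
qed

section \<open>The group determinant\<close>

lemma fourier_twist:
  "fourier (\<lambda>g. \<chi> g * x g) \<psi> = fourier x (\<psi> \<otimes>\<^bsub>character_group G\<^esub> \<chi>)"
  by (simp add: fourier_def character_mult_apply mult_ac)

text \<open>
  Each character, read as the vector \<open>(\<chi>(h\<^sup>-\<^sup>1))\<^sub>h\<close>, is an eigenvector of the group matrix with
  eigenvalue \<open>fourier x \<chi>\<close>. Orthogonality shows that the matrix \<open>C\<close> of all these vectors is
  invertible, so the group matrix is similar to the diagonal matrix \<open>D\<close> of the eigenvalues.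
\<close>

lemma group_det_eq_prod_fourier:
  assumes e: "bij_betw e {..<card (carrier G)} (carrier G)"
  shows "group_det G e x = (\<Prod>\<chi>\<in>characters. fourier x \<chi>)"
proof -
  define n where "n = card (carrier G)"
  have e_in: "e i \<in> carrier G" if "i < n" for i
    using e that unfolding n_def bij_betw_def by blast
  have sum_e: "(\<Sum>i<n. F (e i)) = (\<Sum>g\<in>carrier G. F g)" for F :: "'a \<Rightarrow> complex"
    using sum.reindex_bij_betw[OF e] by (simp add: n_def)
  obtain f where f: "bij_betw f {..<n} characters"
    using ex_bij_betw_nat_finite[OF finite_characters]
    by (auto simp: card_characters n_def atLeast0LessThan)
  have f_in: "f j \<in> characters" if "j < n" for j
    using f that unfolding bij_betw_def by blast
  have sum_f: "(\<Sum>j<n. F (f j)) = (\<Sum>\<chi>\<in>characters. F \<chi>)" for F :: "('a \<Rightarrow> complex) \<Rightarrow> complex"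
    using sum.reindex_bij_betw[OF f] by simp
  define X where "X = mat n n (\<lambda>(i, j). x (e i \<otimes> inv (e j)))"
  define C where "C = mat n n (\<lambda>(i, j). f j (inv (e i)))"
  define C' where "C' = mat n n (\<lambda>(i, j). f i (e j))"
  define D where "D = mat n n (\<lambda>(i, j). if i = j then fourier x (f j) else 0)"
  have dims [simp]: "X \<in> carrier_mat n n" "C \<in> carrier_mat n n" "C' \<in> carrier_mat n n" "D \<in> carrier_mat n n"
    by (simp_all add: X_def C_def C'_def D_def)
  have "X * C = C * D"
  proof (rule eq_matI)
    fix i j assume "i < dim_row (C * D)" "j < dim_col (C * D)"
    then have ij: "i < n" "j < n" by (simp_all add: C_def D_def)
    let ?g = "e i" and ?\<chi> = "f j"
    have g: "?g \<in> carrier G" and \<chi>: "?\<chi> \<in> characters" using ij e_in f_in by auto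
    have "(X * C) $$ (i, j) = (\<Sum>k<n. x (?g \<otimes> inv (e k)) * ?\<chi> (inv (e k)))"
      using ij by (simp add: X_def C_def scalar_prod_def atLeast0LessThan)
    also have "\<dots> = (\<Sum>h\<in>carrier G. x (?g \<otimes> inv h) * ?\<chi> (inv h))"
      by (rule sum_e)
    \<comment> \<open>Substitute \<open>k = g h\<^sup>-\<^sup>1\<close>, so that \<open>h\<^sup>-\<^sup>1 = g\<^sup>-\<^sup>1 k\<close>.\<close>
    also have "\<dots> = (\<Sum>k\<in>carrier G. x k * ?\<chi> (inv ?g \<otimes> k))"
      by (rule sum.reindex_bij_witness[where i = "\<lambda>k. inv k \<otimes> ?g" and j = "\<lambda>h. ?g \<otimes> inv h"])
        (use g in \<open>simp_all add: inv_mult_group m_assoc m_assoc[symmetric]\<close>)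
    also have "\<dots> = ?\<chi> (inv ?g) * fourier x ?\<chi>"
      unfolding fourier_def sum_distrib_left
      by (rule sum.cong) (use g \<chi> in \<open>simp_all add: character_mult\<close>)
    also have "\<dots> = (C * D) $$ (i, j)"
      using ij by (simp add: C_def D_def scalar_prod_def if_distrib sum.delta cong: if_cong)
    finally show "(X * C) $$ (i, j) = (C * D) $$ (i, j)" .
  qed (simp_all add: X_def C_def D_def)
  then have "det X * det C = det C * det D"
    using det_mult[of X n C] det_mult[of C n D] dims by metis
  moreover have "det C \<noteq> 0"
  proof -
    have "C * C' = of_nat n \<cdot>\<^sub>m 1\<^sub>m n"
    proof (rule eq_matI)
      fix i j assume "i < dim_row (of_nat n \<cdot>\<^sub>m 1\<^sub>m n :: complex mat)"
        "j < dim_col (of_nat n \<cdot>\<^sub>m 1\<^sub>m n :: complex mat)"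
      then have ij: "i < n" "j < n" by simp_all
      then have eij: "e i \<in> carrier G" "e j \<in> carrier G" using e_in by auto
      have "(C * C') $$ (i, j) = (\<Sum>k<n. f k (inv (e i)) * f k (e j))"
        using ij by (simp add: C_def C'_def scalar_prod_def atLeast0LessThan)
      also have "\<dots> = (\<Sum>\<chi>\<in>characters. \<chi> (inv (e i)) * \<chi> (e j))"
        by (rule sum_f)
      also have "\<dots> = (\<Sum>\<chi>\<in>characters. \<chi> (inv (e i) \<otimes> e j))"
        using eij by (simp add: character_mult)
      also have "\<dots> = (if inv (e i) \<otimes> e j = \<one> then of_nat n else 0)"
        using eij by (simp add: sum_characters_at n_def)
      also have "inv (e i) \<otimes> e j = \<one> \<longleftrightarrow> e i = e j"
        using eij by (metis inv_closed inv_equality l_inv inv_inv)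
      also have "e i = e j \<longleftrightarrow> i = j"
        using e ij unfolding n_def bij_betw_def by (auto dest: inj_onD)
      finally show "(C * C') $$ (i, j) = (of_nat n \<cdot>\<^sub>m 1\<^sub>m n) $$ (i, j)"
        using ij by simp
    qed (simp_all add: C_def C'_def)
    then have "det C * det C' = of_nat n ^ n"
      using det_mult[of C n C'] by (simp add: det_smult)
    moreover have "n \<noteq> 0" using finite_carrier by (auto simp: n_def)
    ultimately show ?thesis by auto
  qed
  ultimately have "det X = det D" by simp
  also have "det D = (\<Prod>j<n. fourier x (f j))"
  proof -
    have "det D = prod_list (diag_mat D)"
      by (rule det_upper_triangular[OF _ dims(4)]) (auto simp: D_def)
    also have "\<dots> = (\<Prod>j<n. fourier x (f j))"
      by (simp add: prod_list_diag_prod D_def atLeast0LessThan)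
    finally show ?thesis .
  qed
  also have "\<dots> = (\<Prod>\<chi>\<in>characters. fourier x \<chi>)"
    by (rule prod.reindex_bij_betw[OF f])
  finally show ?thesis by (simp add: group_det_def X_def n_def)
qed

text \<open>
  The untwisted factor is the twist by the trivial character, which completes the product to one
  over all \<open>\<chi>\<close>; multiplication by \<open>\<psi>\<close> permutes the characters.
\<close>

lemma prod_fourier_twists:
  assumes "\<psi> \<in> characters"
  shows "fourier x \<psi> * (\<Prod>\<chi>\<in>characters - {\<one>\<^bsub>character_group G\<^esub>}. fourier (\<lambda>g. \<chi> g * x g) \<psi>) =
    (\<Prod>\<chi>\<in>characters. fourier x \<chi>)"
proof -
  have "fourier x \<psi> = fourier (\<lambda>g. \<one>\<^bsub>character_group G\<^esub> g * x g) \<psi>"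
    by (simp add: fourier_def character_group_def)
  then have "fourier x \<psi> * (\<Prod>\<chi>\<in>characters - {\<one>\<^bsub>character_group G\<^esub>}. fourier (\<lambda>g. \<chi> g * x g) \<psi>) =
      (\<Prod>\<chi>\<in>characters. fourier (\<lambda>g. \<chi> g * x g) \<psi>)"
    using prod.remove[OF finite_characters trivial_character,
        of "\<lambda>\<chi>. fourier (\<lambda>g. \<chi> g * x g) \<psi>"] by simp
  also have "\<dots> = (\<Prod>\<chi>\<in>characters. fourier x \<chi>)"
    unfolding fourier_twist by (rule prod.reindex_bij_betw[OF bij_character_mult[OF assms]])
  finally show ?thesis .
qed

end

section \<open>The inverse in the group algebra\<close>

theorem corollary5:
  fixes G :: "('a, 'm) monoid_scheme" and x :: "'a \<Rightarrow> complex" and e :: "nat \<Rightarrow> 'a"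
  assumes "comm_group G" and "finite (carrier G)"
    and "bij_betw e {..<card (carrier G)} (carrier G)"
    and "group_det G e x \<noteq> 0"
  defines "A \<equiv> group_algebra G"
  shows "(\<Oplus>\<^bsub>A\<^esub>g\<in>carrier G. x g \<odot>\<^bsub>A\<^esub> group_elem g) \<in> Units A \<and>
    inv\<^bsub>A\<^esub> (\<Oplus>\<^bsub>A\<^esub>g\<in>carrier G. x g \<odot>\<^bsub>A\<^esub> group_elem g) =
      (1 / group_det G e x) \<odot>\<^bsub>A\<^esub>
        (\<Otimes>\<^bsub>A\<^esub>\<chi>\<in>carrier (character_group G) - {\<one>\<^bsub>character_group G\<^esub>}.
          \<Oplus>\<^bsub>A\<^esub>g\<in>carrier G. (\<chi> g * x g) \<odot>\<^bsub>A\<^esub> group_elem g)"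
proof -
  interpret finite_comm_group G
    by (intro finite_comm_group.intro finite_comm_group_axioms.intro assms)
  interpret A: cring A unfolding A_def by (rule group_algebra_cring)
  let ?elt = "\<lambda>y. \<Oplus>\<^bsub>A\<^esub>g\<in>carrier G. y g \<odot>\<^bsub>A\<^esub> group_elem g"
  let ?N = "characters - {\<one>\<^bsub>character_group G\<^esub>}"
  let ?P = "\<Otimes>\<^bsub>A\<^esub>\<chi>\<in>?N. ?elt (\<lambda>g. \<chi> g * x g)"
  let ?b = "(1 / group_det G e x) \<odot>\<^bsub>A\<^esub> ?P"
  have elt: "?elt y \<in> carrier A" for y
    unfolding A_def by (rule group_algebra_combination_closed)
  have P: "?P \<in> carrier A" by (intro A.finprod_closed) (simp add: elt)
  then have b: "?b \<in> carrier A" unfolding A_def by (rule group_algebra_smult_closed)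
  have inverse: "?elt x \<otimes>\<^bsub>A\<^esub> ?b = \<one>\<^bsub>A\<^esub>"
  proof (rule fourier_eqI)
    fix \<psi> assume \<psi>: "\<psi> \<in> characters"
    have "fourier ?P \<psi> = (\<Prod>\<chi>\<in>?N. fourier (\<lambda>g. \<chi> g * x g) \<psi>)"
      using fourier_finprod[OF _ _ \<psi>, of ?N "\<lambda>\<chi>. ?elt (\<lambda>g. \<chi> g * x g)"] finite_characters elt
      by (simp add: A_def fourier_combination)
    then have "fourier (?elt x \<otimes>\<^bsub>A\<^esub> ?b) \<psi> =
        1 / group_det G e x * (fourier x \<psi> * (\<Prod>\<chi>\<in>?N. fourier (\<lambda>g. \<chi> g * x g) \<psi>))"
      using fourier_mult[OF _ _ \<psi>, of "?elt x" ?b] elt b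
      by (simp add: A_def fourier_combination fourier_smult)
    also have "\<dots> = 1"
      using assms(4) by (simp only: prod_fourier_twists[OF \<psi>] flip: group_det_eq_prod_fourier[OF assms(3)]) simp
    finally show "fourier (?elt x \<otimes>\<^bsub>A\<^esub> ?b) \<psi> = fourier \<one>\<^bsub>A\<^esub> \<psi>"
      using fourier_one[OF \<psi>] by (simp add: A_def)
  qed (use elt b in \<open>simp_all flip: A_def\<close>)
  then have inverse': "?b \<otimes>\<^bsub>A\<^esub> ?elt x = \<one>\<^bsub>A\<^esub>" using A.m_comm[OF elt b] by simp
  have "?elt x \<in> Units A" unfolding Units_def using elt b inverse inverse' by blast
  moreover have "inv\<^bsub>A\<^esub> (?elt x) = ?b" by (rule A.inv_unique'[OF elt b inverse inverse', symmetric])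
  ultimately show ?thesis by blast
qed

end
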